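(* Let $\mathcal{C}$ be a simplicial complex on ground set $[m]$ and $\mathbf{d}$ an integer vector with entries $\ge2$, and assume $\mathcal{A}_{\mathcal{C},\mathbf{d}}$ is compressed. Let $v$ be a vertex of $\mathcal{C}$ and let $\mathbf{d}'$ be obtained from $\mathbf{d}$ by deleting the entry for $v$. Then $\mathcal{A}_{\mathrm{link}_v(\mathcal{C}),\mathbf{d}'}$ is compressed.
   Context: $\mathcal{A}_{\mathcal{C},\mathbf{d}}$ has columns indexed by $\mathbf{i}\in\prod_{j\in[m]}[d_j]$ and rows indexed by pairs $(F,e)$, $F$ a facet of $\mathcal{C}$, $e\in\prod_{j\in F}[d_j]$; entry $1$ if $e=(i_j:j\in F)$, else $0$. The toric ideal of a matrix $A$ with $n$ columns is $I_A=\langle x^u-x^v:u,v\in\mathbb{N}^n, Au=Av\rangle\subseteq\mathbb{K}[x_1,\dots,x_n]$. An integer matrix $A$ with homogeneous toric ideal is compressed if the initial ideal $\mathrm{in}_\prec(I_A)$ is generated by squarefree monomials for every reverse lexicographic term order $\prec$. The link is $\mathrm{link}_v(\mathcal{C})=\{F\setminus\{v\}:F\in\mathcal{C},v\in F\}$, on ground set $[m]\setminus\{v\}$. *)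

theory Defs
  imports "HOL-Library.Poly_Mapping" "HOL-Library.FuncSet" "HOL-Algebra.Ideal"
begin

section \<open>Polynomial rings\<close>

text \<open>
  A monomial is identified with its exponent vector, a finitely supported function of type
  \<open>'x \<Rightarrow>\<^sub>0 nat\<close>; a polynomial over \<open>'k\<close> is a finitely supported function of type
  \<open>('x \<Rightarrow>\<^sub>0 nat) \<Rightarrow>\<^sub>0 'k\<close>, with convolution as multiplication.  The ring
  \<open>poly_ring X\<close> consists of the polynomials that involve only the variables in \<open>X\<close>, so that
  all ideals below are ideals of the ring in exactly these variables, whatever the type \<open>'x\<close>.
\<close>

definition monomials :: "'x set \<Rightarrow> ('x \<Rightarrow>\<^sub>0 nat) set"
  where "monomials X = {t. Poly_Mapping.keys t \<subseteq> X}"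

definition poly_ring :: "'x set \<Rightarrow> (('x \<Rightarrow>\<^sub>0 nat) \<Rightarrow>\<^sub>0 'k::field) ring"
  where "poly_ring X =
    \<lparr>carrier = {p. Poly_Mapping.keys p \<subseteq> monomials X}, mult = (*), one = 1, zero = 0, add = (+)\<rparr>"

lemma keys_mult_monomials:
  fixes p q :: "('x \<Rightarrow>\<^sub>0 nat) \<Rightarrow>\<^sub>0 'k::field"
  assumes "Poly_Mapping.keys p \<subseteq> monomials X" "Poly_Mapping.keys q \<subseteq> monomials X"
  shows "Poly_Mapping.keys (p * q) \<subseteq> monomials X"
proof
  fix t assume "t \<in> Poly_Mapping.keys (p * q)"
  then obtain a b where "t = a + b" "a \<in> Poly_Mapping.keys p" "b \<in> Poly_Mapping.keys q"
    using keys_mult[of p q] by blast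
  then show "t \<in> monomials X"
    using assms keys_add[of a b] unfolding monomials_def by blast
qed

lemma cring_poly_ring: "cring (poly_ring X :: (('x \<Rightarrow>\<^sub>0 nat) \<Rightarrow>\<^sub>0 'k::field) ring)"
proof (rule cringI)
  show "abelian_group (poly_ring X :: (('x \<Rightarrow>\<^sub>0 nat) \<Rightarrow>\<^sub>0 'k) ring)"
  proof (rule abelian_groupI)
    fix p :: "('x \<Rightarrow>\<^sub>0 nat) \<Rightarrow>\<^sub>0 'k"
    assume "p \<in> carrier (poly_ring X)"
    then show "\<exists>q\<in>carrier (poly_ring X). q \<oplus>\<^bsub>poly_ring X\<^esub> p = \<zero>\<^bsub>poly_ring X\<^esub>"
      by (intro bexI[of _ "- p"]) (auto simp: poly_ring_def keys.rep_eq)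
  qed (use keys_add in \<open>auto simp: poly_ring_def add.assoc add.commute\<close>, fastforce)
  show "Group.comm_monoid (poly_ring X :: (('x \<Rightarrow>\<^sub>0 nat) \<Rightarrow>\<^sub>0 'k) ring)"
  proof (rule comm_monoidI)
    show "\<one>\<^bsub>poly_ring X\<^esub> \<in> carrier (poly_ring X :: (('x \<Rightarrow>\<^sub>0 nat) \<Rightarrow>\<^sub>0 'k) ring)"
      by (simp add: poly_ring_def monomials_def)
  qed (auto simp: poly_ring_def mult.assoc mult.commute dest: subsetD[OF keys_mult_monomials])
qed (auto simp: poly_ring_def distrib_right)


section \<open>Initial ideals for reverse lexicographic term orders\<close>

definition monom_deg :: "('x \<Rightarrow>\<^sub>0 nat) \<Rightarrow> nat"
  where "monom_deg t = (\<Sum>x\<in>Poly_Mapping.keys t. Poly_Mapping.lookup t x)"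

text \<open>
  The (graded) reverse lexicographic strict order on the monomials in \<open>X\<close> that is induced by a
  linear order \<open>r\<close> on the variables, where \<open>(y, x) \<in> r\<close> means \<open>y \<le> x\<close>: among monomials of the
  same degree, \<open>s\<close> is smaller than \<open>t\<close> if the smallest variable whose exponents differ has the
  larger exponent in \<open>s\<close>.
\<close>

definition revlex :: "'x set \<Rightarrow> 'x rel \<Rightarrow> ('x \<Rightarrow>\<^sub>0 nat) \<Rightarrow> ('x \<Rightarrow>\<^sub>0 nat) \<Rightarrow> bool"
  where "revlex X r s t \<longleftrightarrow>
    monom_deg s < monom_deg t \<or>
    monom_deg s = monom_deg t \<and>
      (\<exists>x\<in>X. Poly_Mapping.lookup s x > Poly_Mapping.lookup t x \<and>
        (\<forall>y\<in>X. (y, x) \<in> r \<and> y \<noteq> x \<longrightarrow> Poly_Mapping.lookup s y = Poly_Mapping.lookup t y))"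

definition is_leading_monomial ::
    "(('x \<Rightarrow>\<^sub>0 nat) \<Rightarrow> ('x \<Rightarrow>\<^sub>0 nat) \<Rightarrow> bool) \<Rightarrow> (('x \<Rightarrow>\<^sub>0 nat) \<Rightarrow>\<^sub>0 'k::field) \<Rightarrow> ('x \<Rightarrow>\<^sub>0 nat) \<Rightarrow> bool"
  where "is_leading_monomial lt p t \<longleftrightarrow>
    t \<in> Poly_Mapping.keys p \<and> (\<forall>s\<in>Poly_Mapping.keys p. s \<noteq> t \<longrightarrow> lt s t)"

text \<open>The zero polynomial has no leading monomial, so it contributes no generator here.\<close>

definition initial_ideal ::
    "'x set \<Rightarrow> (('x \<Rightarrow>\<^sub>0 nat) \<Rightarrow> ('x \<Rightarrow>\<^sub>0 nat) \<Rightarrow> bool) \<Rightarrow>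
     (('x \<Rightarrow>\<^sub>0 nat) \<Rightarrow>\<^sub>0 'k::field) set \<Rightarrow> (('x \<Rightarrow>\<^sub>0 nat) \<Rightarrow>\<^sub>0 'k) set"
  where "initial_ideal X lt I =
    Idl\<^bsub>poly_ring X\<^esub> {Poly_Mapping.single t 1 |t. \<exists>p\<in>I. is_leading_monomial lt p t}"

definition squarefree_monomials :: "'x set \<Rightarrow> ('x \<Rightarrow>\<^sub>0 nat) set"
  where "squarefree_monomials X = {t \<in> monomials X. \<forall>x. Poly_Mapping.lookup t x \<le> 1}"

definition squarefree_monomial_ideal :: "'x set \<Rightarrow> (('x \<Rightarrow>\<^sub>0 nat) \<Rightarrow>\<^sub>0 'k::field) set \<Rightarrow> bool"
  where "squarefree_monomial_ideal X I \<longleftrightarrow>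
    (\<exists>S \<subseteq> squarefree_monomials X. I = Idl\<^bsub>poly_ring X\<^esub> ((\<lambda>t. Poly_Mapping.single t 1) ` S))"

definition homogeneous_poly :: "(('x \<Rightarrow>\<^sub>0 nat) \<Rightarrow>\<^sub>0 'k::field) \<Rightarrow> bool"
  where "homogeneous_poly p \<longleftrightarrow> (\<exists>n. \<forall>t\<in>Poly_Mapping.keys p. monom_deg t = n)"

definition homogeneous_ideal :: "'x set \<Rightarrow> (('x \<Rightarrow>\<^sub>0 nat) \<Rightarrow>\<^sub>0 'k::field) set \<Rightarrow> bool"
  where "homogeneous_ideal X I \<longleftrightarrow>
    (\<exists>S \<subseteq> carrier (poly_ring X). (\<forall>p\<in>S. homogeneous_poly p) \<and> I = Idl\<^bsub>poly_ring X\<^esub> S)"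


section \<open>Toric ideals and compressed matrices\<close>

text \<open>
  An integer matrix is given by a set \<open>R\<close> of row indices, a finite set \<open>X\<close> of column indices
  and its entries \<open>A r x\<close>.  The column indices are also the variables of the polynomial ring.
\<close>

definition same_image :: "'r set \<Rightarrow> 'x set \<Rightarrow> ('r \<Rightarrow> 'x \<Rightarrow> int) \<Rightarrow> ('x \<Rightarrow>\<^sub>0 nat) \<Rightarrow> ('x \<Rightarrow>\<^sub>0 nat) \<Rightarrow> bool"
  where "same_image R X A u w \<longleftrightarrow>
    (\<forall>r\<in>R. (\<Sum>x\<in>X. A r x * int (Poly_Mapping.lookup u x)) = (\<Sum>x\<in>X. A r x * int (Poly_Mapping.lookup w x)))"

definition toric_ideal ::
    "'r set \<Rightarrow> 'x set \<Rightarrow> ('r \<Rightarrow> 'x \<Rightarrow> int) \<Rightarrow> (('x \<Rightarrow>\<^sub>0 nat) \<Rightarrow>\<^sub>0 'k::field) set"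
  where "toric_ideal R X A =
    Idl\<^bsub>poly_ring X\<^esub> {Poly_Mapping.single u 1 - Poly_Mapping.single w 1 |u w.
      u \<in> monomials X \<and> w \<in> monomials X \<and> same_image R X A u w}"

text \<open>The first argument fixes the coefficient field.\<close>

definition compressed :: "'k::field itself \<Rightarrow> 'r set \<Rightarrow> 'x set \<Rightarrow> ('r \<Rightarrow> 'x \<Rightarrow> int) \<Rightarrow> bool"
  where "compressed K R X A \<longleftrightarrow>
    homogeneous_ideal X (toric_ideal R X A :: (('x \<Rightarrow>\<^sub>0 nat) \<Rightarrow>\<^sub>0 'k) set) \<and>
    (\<forall>r. linear_order_on X r \<longrightarrow>
      squarefree_monomial_ideal X
        (initial_ideal X (revlex X r) (toric_ideal R X A :: (('x \<Rightarrow>\<^sub>0 nat) \<Rightarrow>\<^sub>0 'k) set)))"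


section \<open>Simplicial complexes and hierarchical models\<close>

text \<open>Elements of the ground set \<open>V\<close> need not be vertices of the complex.\<close>

definition simplicial_complex :: "'v set \<Rightarrow> 'v set set \<Rightarrow> bool"
  where "simplicial_complex V C \<longleftrightarrow> C \<subseteq> Pow V \<and> (\<forall>F\<in>C. \<forall>G. G \<subseteq> F \<longrightarrow> G \<in> C)"

definition facets :: "'v set set \<Rightarrow> 'v set set"
  where "facets C = {F \<in> C. \<forall>G\<in>C. F \<subseteq> G \<longrightarrow> G = F}"

definition link :: "'v \<Rightarrow> 'v set set \<Rightarrow> 'v set set"
  where "link v C = {F - {v} |F. F \<in> C \<and> v \<in> F}"

text \<open>
  Row indices, column indices and entries of the matrix of a complex \<open>C\<close> on the ground set \<open>V\<close>
  with \<open>d j\<close> levels for \<open>j \<in> V\<close>.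
\<close>

definition hier_rows :: "'v set set \<Rightarrow> ('v \<Rightarrow> nat) \<Rightarrow> ('v set \<times> ('v \<Rightarrow> nat)) set"
  where "hier_rows C d = (SIGMA F:facets C. \<Pi>\<^sub>E j\<in>F. {1..d j})"

definition hier_cols :: "'v set \<Rightarrow> ('v \<Rightarrow> nat) \<Rightarrow> ('v \<Rightarrow> nat) set"
  where "hier_cols V d = (\<Pi>\<^sub>E j\<in>V. {1..d j})"

definition hier_entry :: "'v set \<times> ('v \<Rightarrow> nat) \<Rightarrow> ('v \<Rightarrow> nat) \<Rightarrow> int"
  where "hier_entry = (\<lambda>(F, e) i. if e = restrict i F then 1 else 0)"

definition hier_compressed :: "'k::field itself \<Rightarrow> 'v set \<Rightarrow> 'v set set \<Rightarrow> ('v \<Rightarrow> nat) \<Rightarrow> bool"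
  where "hier_compressed K V C d \<longleftrightarrow> compressed K (hier_rows C d) (hier_cols V d) hier_entry"

end

theory Submission
  imports Defs
begin

text \<open>
  Call a monomial nonstandard if it is not the revlex smallest one in its fibre. The initial ideal
  is generated by squarefree monomials iff the squarefree part of every nonstandard monomial is
  nonstandard. Let \<open>u\<close> be nonstandard for the link and let \<open>w\<close> be the smallest monomial of its
  fibre. Placing \<open>u\<close> on level 1 and \<open>w\<close> on level 2 of \<open>v\<close>, or the other way round, gives two
  monomials in the same fibre for \<open>C\<close>: facets avoiding \<open>v\<close> only see the sum of the levels. For an
  order in which level 1 comes first, the stack \<open>(u, w)\<close> is therefore nonstandard, hence so is
  \<open>(\<surd>u, \<surd>w)\<close>. A smaller monomial in the fibre of the latter first differs from it on level 1 or 2,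
  so \<open>\<surd>u\<close> or \<open>\<surd>w\<close> is nonstandard for the link; but \<open>\<surd>w\<close> divides \<open>w\<close>, which is standard.
\<close>

section \<open>Monomial and toric ideals\<close>

lemma sum_lookup_single: "p = (\<Sum>t\<in>Poly_Mapping.keys p. Poly_Mapping.single t (Poly_Mapping.lookup p t))"
proof (rule poly_mapping_eqI)
  fix k
  show "Poly_Mapping.lookup p k =
    Poly_Mapping.lookup (\<Sum>t\<in>Poly_Mapping.keys p. Poly_Mapping.single t (Poly_Mapping.lookup p t)) k"
  proof (cases "k \<in> Poly_Mapping.keys p")
    case True
    then show ?thesis by (simp add: lookup_sum lookup_single when_def)
  next
    case False
    then show ?thesis
      by (auto simp: lookup_sum lookup_single when_def in_keys_iff intro!: sum.neutral[symmetric])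
  qed
qed

lemma carrier_poly_ring: "p \<in> carrier (poly_ring X) \<longleftrightarrow> Poly_Mapping.keys p \<subseteq> monomials X"
  by (simp add: poly_ring_def)

lemma ring_poly_ring: "ring (poly_ring X :: (('x \<Rightarrow>\<^sub>0 nat) \<Rightarrow>\<^sub>0 'k::field) ring)"
  using cring_poly_ring by (rule cring.axioms(1))

lemma zero_monomials: "0 \<in> monomials X"
  by (simp add: monomials_def)

lemma monomials_add: "s \<in> monomials X \<Longrightarrow> t \<in> monomials X \<Longrightarrow> s + t \<in> monomials X"
  using keys_add[of s t] unfolding monomials_def by blast

text \<open>Closure under negation follows from the other conditions, since \<open>- p\<close> is
  the product of \<open>p\<close> with the ring element \<open>-1\<close>.\<close>

lemma ideal_poly_ringI:
  fixes J :: "(('x \<Rightarrow>\<^sub>0 nat) \<Rightarrow>\<^sub>0 'k::field) set"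
  assumes carr: "J \<subseteq> carrier (poly_ring X)" and zero: "0 \<in> J"
    and add: "\<And>p q. p \<in> J \<Longrightarrow> q \<in> J \<Longrightarrow> p + q \<in> J"
    and mult: "\<And>p q. p \<in> J \<Longrightarrow> q \<in> carrier (poly_ring X) \<Longrightarrow> q * p \<in> J"
  shows "ideal J (poly_ring X)"
proof -
  interpret P: cring "poly_ring X :: (('x \<Rightarrow>\<^sub>0 nat) \<Rightarrow>\<^sub>0 'k) ring" by (rule cring_poly_ring)
  have neg: "\<ominus>\<^bsub>poly_ring X\<^esub> p \<in> J" if "p \<in> J" for p
  proof -
    have "\<ominus>\<^bsub>poly_ring X\<^esub> p = (\<ominus>\<^bsub>poly_ring X\<^esub> \<one>\<^bsub>poly_ring X\<^esub>) \<otimes>\<^bsub>poly_ring X\<^esub> p"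
      using that carr by (simp add: P.l_minus subset_iff)
    also have "\<dots> = (\<ominus>\<^bsub>poly_ring X\<^esub> \<one>\<^bsub>poly_ring X\<^esub>) * p"
      by (simp add: poly_ring_def)
    also have "\<dots> \<in> J" by (rule mult[OF that]) simp
    finally show ?thesis .
  qed
  have "subgroup J (add_monoid (poly_ring X))"
  proof (rule group.subgroupI)
    show "Group.group (add_monoid (poly_ring X :: (('x \<Rightarrow>\<^sub>0 nat) \<Rightarrow>\<^sub>0 'k) ring))"
      by (rule P.a_group)
  qed (use carr zero add neg in \<open>auto simp: a_inv_def poly_ring_def\<close>)
  then show ?thesis
  proof (rule idealI[OF ring_poly_ring])
    fix p q :: "('x \<Rightarrow>\<^sub>0 nat) \<Rightarrow>\<^sub>0 'k"
    assume "p \<in> J" and q: "q \<in> carrier (poly_ring X)"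
    then have "q * p \<in> J" by (rule mult)
    then show "q \<otimes>\<^bsub>poly_ring X\<^esub> p \<in> J" "p \<otimes>\<^bsub>poly_ring X\<^esub> q \<in> J"
      by (simp_all add: poly_ring_def mult.commute)
  qed
qed

text \<open>The polynomials all of whose monomials are multiples of members of \<open>S\<close> form
  an ideal that contains the generators, hence the whole generated ideal. Applied to a single
  monomial, this turns ideal membership into divisibility.\<close>

lemma single_mem_monomial_ideal_iff:
  assumes S: "S \<subseteq> monomials X" and t: "t \<in> monomials X"
  shows "(Poly_Mapping.single t 1 :: ('x \<Rightarrow>\<^sub>0 nat) \<Rightarrow>\<^sub>0 'k::field) \<in>
      Idl\<^bsub>poly_ring X\<^esub> ((\<lambda>s. Poly_Mapping.single s 1) ` S) \<longleftrightarrow>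
    (\<exists>s\<in>S. \<exists>a\<in>monomials X. t = a + s)"
    (is "?l \<in> Idl\<^bsub>?P\<^esub> ?G \<longleftrightarrow> ?r")
proof -
  interpret P: cring ?P by (rule cring_poly_ring)
  have G: "?G \<subseteq> carrier ?P" using S by (auto simp: carrier_poly_ring)
  show ?thesis
  proof
    assume ?r
    then obtain s a where s: "s \<in> S" "a \<in> monomials X" "t = a + s" by blast
    have "Poly_Mapping.single a 1 \<otimes>\<^bsub>?P\<^esub> Poly_Mapping.single s 1 \<in> Idl\<^bsub>?P\<^esub> ?G"
      by (rule ideal.I_l_closed[OF P.genideal_ideal[OF G]])
        (use s P.genideal_self[OF G] in \<open>auto simp: carrier_poly_ring\<close>)
    then show "?l \<in> Idl\<^bsub>?P\<^esub> ?G"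
      by (simp add: poly_ring_def mult_single s)
  next
    define J where "J = {p::('x \<Rightarrow>\<^sub>0 nat) \<Rightarrow>\<^sub>0 'k.
      \<forall>t\<in>Poly_Mapping.keys p. \<exists>s\<in>S. \<exists>a\<in>monomials X. t = a + s}"
    assume "?l \<in> Idl\<^bsub>?P\<^esub> ?G"
    moreover have "Idl\<^bsub>?P\<^esub> ?G \<subseteq> J"
    proof (rule P.genideal_minimal)
      show "ideal J ?P"
      proof (rule ideal_poly_ringI)
        show "J \<subseteq> carrier ?P"
          using S monomials_add by (fastforce simp: J_def carrier_poly_ring)
        show "0 \<in> J" by (simp add: J_def)
        show "p + q \<in> J" if "p \<in> J" "q \<in> J" for p q
          using that keys_add[of p q] by (auto simp: J_def)
        show "q * p \<in> J" if "p \<in> J" "q \<in> carrier ?P" for p q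
          unfolding J_def
        proof (intro CollectI ballI)
          fix t assume "t \<in> Poly_Mapping.keys (q * p)"
          then obtain a b where ab: "t = a + b" "a \<in> Poly_Mapping.keys q" "b \<in> Poly_Mapping.keys p"
            using keys_mult[of q p] by blast
          then obtain s c where "s \<in> S" "c \<in> monomials X" "b = c + s"
            using \<open>p \<in> J\<close> unfolding J_def by blast
          moreover have "a \<in> monomials X" using ab that by (auto simp: carrier_poly_ring)
          ultimately show "\<exists>s\<in>S. \<exists>a\<in>monomials X. t = a + s"
            using ab monomials_add by (metis add.assoc)
        qed
      qed
      show "?G \<subseteq> J"
        using zero_monomials[of X] by (auto simp: J_def) (metis add_0)
    qed
    ultimately have "?l \<in> J" by blast
    then show ?r by (auto simp: J_def)
  qed
qed

section \<open>Linear functionals that add up selected coefficients\<close>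

definition coeff_sum :: "('t \<Rightarrow> bool) \<Rightarrow> ('t \<Rightarrow>\<^sub>0 'k::comm_monoid_add) \<Rightarrow> 'k"
  where "coeff_sum Q p = (\<Sum>t\<in>Poly_Mapping.keys p. if Q t then Poly_Mapping.lookup p t else 0)"

lemma coeff_sum_superset:
  assumes "finite K" "Poly_Mapping.keys p \<subseteq> K"
  shows "coeff_sum Q p = (\<Sum>t\<in>K. if Q t then Poly_Mapping.lookup p t else 0)"
  unfolding coeff_sum_def by (rule sum.mono_neutral_left) (use assms in \<open>auto simp: in_keys_iff\<close>)

lemma coeff_sum_add: "coeff_sum Q (p + q) = coeff_sum Q p + coeff_sum Q q"
proof -
  let ?K = "Poly_Mapping.keys p \<union> Poly_Mapping.keys q"
  show ?thesis
    using keys_add[of p q]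
    by (auto simp: coeff_sum_superset[of ?K] lookup_add sum.distrib[symmetric] intro!: sum.cong)
qed

lemma coeff_sum_zero [simp]: "coeff_sum Q 0 = 0"
  by (simp add: coeff_sum_def)

lemma coeff_sum_sum: "coeff_sum Q (\<Sum>i\<in>I. f i) = (\<Sum>i\<in>I. coeff_sum Q (f i))"
  by (induction I rule: infinite_finite_induct) (auto simp: coeff_sum_add)

lemma coeff_sum_single: "coeff_sum Q (Poly_Mapping.single t c) = (if Q t then c else 0)"
  by (simp add: coeff_sum_def)

text \<open>Multiplication by the monomial \<open>a\<close> moves \<open>t\<close> to
  \<open>a + t\<close>, so the functional for \<open>Q\<close> turns into the one for the translated
  predicate.\<close>

lemma coeff_sum_mult:
  fixes p q :: "'t::monoid_add \<Rightarrow>\<^sub>0 'k::semiring_0"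
  shows "coeff_sum Q (q * p) =
    (\<Sum>a\<in>Poly_Mapping.keys q. Poly_Mapping.lookup q a * coeff_sum (\<lambda>t. Q (a + t)) p)"
proof -
  have "q * p = (\<Sum>a\<in>Poly_Mapping.keys q. \<Sum>t\<in>Poly_Mapping.keys p.
      Poly_Mapping.single (a + t) (Poly_Mapping.lookup q a * Poly_Mapping.lookup p t))"
    by (subst (1) sum_lookup_single[of q], subst (1) sum_lookup_single[of p])
      (simp add: sum_product mult_single)
  then have "coeff_sum Q (q * p) = (\<Sum>a\<in>Poly_Mapping.keys q. \<Sum>t\<in>Poly_Mapping.keys p.
      if Q (a + t) then Poly_Mapping.lookup q a * Poly_Mapping.lookup p t else 0)"
    by (simp add: coeff_sum_sum coeff_sum_single)
  also have "\<dots> = (\<Sum>a\<in>Poly_Mapping.keys q. Poly_Mapping.lookup q a * coeff_sum (\<lambda>t. Q (a + t)) p)"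
    unfolding coeff_sum_def sum_distrib_left by (intro sum.cong refl) simp
  finally show ?thesis .
qed

section \<open>Fibres and the binomials of a toric ideal\<close>

lemma same_image_refl: "same_image R X A t t"
  by (simp add: same_image_def)

lemma same_image_sym: "same_image R X A s t \<Longrightarrow> same_image R X A t s"
  by (simp add: same_image_def)

lemma same_image_trans: "same_image R X A s t \<Longrightarrow> same_image R X A t u \<Longrightarrow> same_image R X A s u"
  by (simp add: same_image_def)

lemma same_image_add: "same_image R X A s t \<Longrightarrow> same_image R X A (a + s) (a + t)"
  by (simp add: same_image_def lookup_add algebra_simps sum.distrib)

lemma toric_generators_carrier:
  "{Poly_Mapping.single u 1 - Poly_Mapping.single w 1 |u w.
      u \<in> monomials X \<and> w \<in> monomials X \<and> same_image R X A u w}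
    \<subseteq> carrier (poly_ring X :: (('x \<Rightarrow>\<^sub>0 nat) \<Rightarrow>\<^sub>0 'k::field) ring)"
proof safe
  fix u w assume "u \<in> monomials X" "w \<in> monomials X"
  then show "Poly_Mapping.single u 1 - Poly_Mapping.single w 1 
      \<in> carrier (poly_ring X :: (('x \<Rightarrow>\<^sub>0 nat) \<Rightarrow>\<^sub>0 'k::field) ring)"
    by (auto simp: carrier_poly_ring in_keys_iff lookup_minus lookup_single when_def split: if_splits)
qed

lemma toric_ideal_carrier: 
  "(toric_ideal R X A :: (('x \<Rightarrow>\<^sub>0 nat) \<Rightarrow>\<^sub>0 'k::field) set) \<subseteq> carrier (poly_ring X)"
  unfolding toric_ideal_def
  by (rule additive_subgroup.a_subset[OF ideal.axioms(1)[OF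
        ring.genideal_ideal[OF ring_poly_ring toric_generators_carrier]]])

lemma toric_idealI:
  assumes "u \<in> monomials X" "w \<in> monomials X" "same_image R X A u w"
  shows "Poly_Mapping.single u 1 - Poly_Mapping.single w 1 
      \<in> (toric_ideal R X A :: (('x \<Rightarrow>\<^sub>0 nat) \<Rightarrow>\<^sub>0 'k::field) set)"
  unfolding toric_ideal_def
  using ring.genideal_self[OF ring_poly_ring toric_generators_carrier] assms by blast

text \<open>The two terms of a generating binomial lie in one fibre, where \<open>Q\<close> is
  constant, so their coefficients cancel. What remains is that this vanishing is inherited by the
  generated ideal.\<close>

lemma coeff_sum_toric_ideal:
  fixes p :: "('x \<Rightarrow>\<^sub>0 nat) \<Rightarrow>\<^sub>0 'k::field"
  assumes p: "p \<in> toric_ideal R X A" and Q: "\<And>s t. same_image R X A s t \<Longrightarrow> Q s = Q t"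
  shows "coeff_sum Q p = 0"
proof -
  define fibrewise where "fibrewise Q \<longleftrightarrow> (\<forall>s t. same_image R X A s t \<longrightarrow> Q s = Q t)" for Q :: "_ \<Rightarrow> bool"
  \<comment> \<open>All fibrewise predicates are required to annihilate at once: a single
    \<open>Q\<close> would not give an ideal, since multiplication replaces it by its translates.
    Translates are fibrewise again because fibres are respected by adding a monomial.\<close>
  define J where "J = {p::('x \<Rightarrow>\<^sub>0 nat) \<Rightarrow>\<^sub>0 'k.
    p \<in> carrier (poly_ring X) \<and> (\<forall>Q. fibrewise Q \<longrightarrow> coeff_sum Q p = 0)}"
  have fibrewise_shift: "fibrewise (\<lambda>t. Q (a + t))" if "fibrewise Q" for Q a
    unfolding fibrewise_def
  proof (intro allI impI)
    fix s t assume "same_image R X A s t"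
    then have "same_image R X A (a + s) (a + t)" by (rule same_image_add)
    then show "Q (a + s) = Q (a + t)" using that unfolding fibrewise_def by simp
  qed
  interpret P: cring "poly_ring X :: (('x \<Rightarrow>\<^sub>0 nat) \<Rightarrow>\<^sub>0 'k) ring" by (rule cring_poly_ring)
  have "toric_ideal R X A \<subseteq> J"
    unfolding toric_ideal_def
  proof (rule P.genideal_minimal)
    show "ideal J (poly_ring X)"
    proof (rule ideal_poly_ringI)
      show "J \<subseteq> carrier (poly_ring X)" by (auto simp: J_def)
      show "0 \<in> J" by (simp add: J_def carrier_poly_ring)
      show "p + q \<in> J" if "p \<in> J" "q \<in> J" for p q
      proof -
        have "Poly_Mapping.keys (p + q) \<subseteq> monomials X"
          using that keys_add[of p q] by (auto simp: J_def carrier_poly_ring)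
        then show ?thesis using that by (simp add: J_def carrier_poly_ring coeff_sum_add)
      qed
      show "q * p \<in> J" if "p \<in> J" "q \<in> carrier (poly_ring X)" for p q
      proof -
        have "Poly_Mapping.keys (q * p) \<subseteq> monomials X"
          using that by (simp add: J_def carrier_poly_ring keys_mult_monomials)
        then show ?thesis
          using that fibrewise_shift by (simp add: J_def carrier_poly_ring coeff_sum_mult)
      qed
    qed
    have gen: "coeff_sum Q (Poly_Mapping.single u 1 - Poly_Mapping.single w (1::'k)) = 0"
      if "Q u = Q w" for u w and Q :: "('x \<Rightarrow>\<^sub>0 nat) \<Rightarrow> bool"
    proof -
      have "coeff_sum Q (Poly_Mapping.single u (1::'k)) =
          coeff_sum Q ((Poly_Mapping.single u 1 - Poly_Mapping.single w 1) + Poly_Mapping.single w 1)"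
        by simp
      also have "\<dots> = coeff_sum Q (Poly_Mapping.single u 1 - Poly_Mapping.single w (1::'k)) +
          coeff_sum Q (Poly_Mapping.single w 1)"
        by (rule coeff_sum_add)
      finally show ?thesis using that by (simp add: coeff_sum_single)
    qed
    show "{Poly_Mapping.single u 1 - Poly_Mapping.single w 1 |u w.
      u \<in> monomials X \<and> w \<in> monomials X \<and> same_image R X A u w} \<subseteq> J"
    proof
      fix p :: "('x \<Rightarrow>\<^sub>0 nat) \<Rightarrow>\<^sub>0 'k"
      assume p: "p \<in> {Poly_Mapping.single u 1 - Poly_Mapping.single w 1 |u w.
        u \<in> monomials X \<and> w \<in> monomials X \<and> same_image R X A u w}"
      then have "p \<in> carrier (poly_ring X)" using toric_generators_carrier by (rule rev_subsetD)
      moreover have "coeff_sum Q p = 0" if "fibrewise Q" for Q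
        using p that gen unfolding fibrewise_def by auto
      ultimately show "p \<in> J" by (simp add: J_def)
    qed
  qed
  then have "p \<in> J" using p by (rule subsetD)
  moreover have "fibrewise Q" using Q by (simp add: fibrewise_def)
  ultimately show ?thesis by (simp add: J_def)
qed

section \<open>Reverse lexicographic orders and standard monomials\<close>

lemma monom_deg_superset:
  assumes "finite K" "Poly_Mapping.keys t \<subseteq> K"
  shows "monom_deg t = (\<Sum>x\<in>K. Poly_Mapping.lookup t x)"
  unfolding monom_deg_def by (rule sum.mono_neutral_left) (use assms in \<open>auto simp: in_keys_iff\<close>)

lemma monom_deg_add: "monom_deg (s + t) = monom_deg s + monom_deg t"
proof -
  let ?K = "Poly_Mapping.keys s \<union> Poly_Mapping.keys t"
  show ?thesis
    using keys_add[of s t] by (simp add: monom_deg_superset[of ?K] lookup_add sum.distrib)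
qed

lemma revlex_irrefl: "\<not> revlex X r t t"
  by (simp add: revlex_def)

lemma revlex_add: "revlex X r s t \<Longrightarrow> revlex X r (a + s) (a + t)"
  by (simp add: revlex_def monom_deg_add lookup_add)

text \<open>When all degrees agree, the smaller of the two deciding variables decides the comparison
  of \<open>s\<close> with \<open>u\<close>.\<close>

lemma revlex_trans:
  assumes r: "linear_order_on X r" and st: "revlex X r s t" and tu: "revlex X r t u"
  shows "revlex X r s u"
proof -
  consider "monom_deg s < monom_deg u" | "monom_deg s = monom_deg t" "monom_deg t = monom_deg u"
    using st tu unfolding revlex_def by linarith
  then show ?thesis
  proof cases
    case 1
    then show ?thesis by (simp add: revlex_def)
  next
    case 2
    then obtain x where x: "x \<in> X" "Poly_Mapping.lookup s x > Poly_Mapping.lookup t x"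
        "\<forall>y\<in>X. (y, x) \<in> r \<and> y \<noteq> x \<longrightarrow> Poly_Mapping.lookup s y = Poly_Mapping.lookup t y"
      using st by (auto simp: revlex_def)
    from 2 tu obtain z where z: "z \<in> X" "Poly_Mapping.lookup t z > Poly_Mapping.lookup u z"
        "\<forall>y\<in>X. (y, z) \<in> r \<and> y \<noteq> z \<longrightarrow> Poly_Mapping.lookup t y = Poly_Mapping.lookup u y"
      by (auto simp: revlex_def)
    have tr: "trans r" and an: "antisym r" and "total_on X r"
      using r by (auto simp: linear_order_on_def partial_order_on_def preorder_on_def)
    then consider "x = z" | "x \<noteq> z" "(x, z) \<in> r" | "x \<noteq> z" "(z, x) \<in> r"
      using x(1) z(1) by (auto simp: total_on_def)
    then show ?thesis
    proof cases
      case 1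
      then show ?thesis using x z 2 by (auto simp: revlex_def intro!: bexI[of _ z])
    next
      case xz: 2
      have "(y, z) \<in> r \<and> y \<noteq> z" if "(y, x) \<in> r" for y
        using that xz tr an by (metis antisymD transD)
      then show ?thesis using x z xz 2 unfolding revlex_def by (metis (no_types, lifting))
    next
      case zx: 3
      have "(y, x) \<in> r \<and> y \<noteq> x" if "(y, z) \<in> r" for y
        using that zx tr an by (metis antisymD transD)
      then show ?thesis using x z zx 2 unfolding revlex_def by (metis (no_types, lifting))
    qed
  qed
qed

section \<open>Nonstandard monomials as leading monomials\<close>

definition nonstandard :: "'r set \<Rightarrow> 'x set \<Rightarrow> ('r \<Rightarrow> 'x \<Rightarrow> int) \<Rightarrow> 'x rel \<Rightarrow> ('x \<Rightarrow>\<^sub>0 nat) \<Rightarrow> bool"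
  where "nonstandard R X A r t \<longleftrightarrow>
    t \<in> monomials X \<and> (\<exists>s\<in>monomials X. same_image R X A s t \<and> revlex X r s t)"

lemma nonstandard_add: "nonstandard R X A r t \<Longrightarrow> a \<in> monomials X \<Longrightarrow> nonstandard R X A r (a + t)"
  unfolding nonstandard_def by (meson monomials_add revlex_add same_image_add)

text \<open>If \<open>s\<close> is a smaller member of the fibre of \<open>t\<close>, the binomial
  of \<open>t\<close> and \<open>s\<close> has leading monomial \<open>t\<close>. Conversely, the
  coefficients of a member of the ideal cancel within each fibre, so its leading monomial shares a
  fibre with another of its monomials, which is smaller.\<close>

lemma leading_monomial_toric_ideal_iff:
  "(\<exists>p \<in> (toric_ideal R X A :: (('x \<Rightarrow>\<^sub>0 nat) \<Rightarrow>\<^sub>0 'k::field) set).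
      is_leading_monomial (revlex X r) p t) \<longleftrightarrow> nonstandard R X A r t"
proof
  assume "nonstandard R X A r t"
  then obtain s where s: "t \<in> monomials X" "s \<in> monomials X" "same_image R X A t s" "revlex X r s t"
    by (auto simp: nonstandard_def intro: same_image_sym)
  then have "s \<noteq> t" using revlex_irrefl by blast
  then have "is_leading_monomial (revlex X r) (Poly_Mapping.single t 1 - Poly_Mapping.single s (1::'k)) t"
    using s by (auto simp: is_leading_monomial_def in_keys_iff lookup_minus lookup_single when_def
        split: if_splits)
  then show "\<exists>p \<in> (toric_ideal R X A :: (('x \<Rightarrow>\<^sub>0 nat) \<Rightarrow>\<^sub>0 'k::field) set).
      is_leading_monomial (revlex X r) p t"
    using toric_idealI s by blast
next
  assume "\<exists>p \<in> (toric_ideal R X A :: (('x \<Rightarrow>\<^sub>0 nat) \<Rightarrow>\<^sub>0 'k::field) set).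
      is_leading_monomial (revlex X r) p t"
  then obtain p :: "('x \<Rightarrow>\<^sub>0 nat) \<Rightarrow>\<^sub>0 'k" where
    p: "p \<in> toric_ideal R X A" "is_leading_monomial (revlex X r) p t" by blast
  have keys: "Poly_Mapping.keys p \<subseteq> monomials X"
    using p(1) toric_ideal_carrier carrier_poly_ring by blast
  have t: "t \<in> Poly_Mapping.keys p" using p by (simp add: is_leading_monomial_def)
  \<comment> \<open>The predicate selects the fibre of \<open>t\<close>. As the coefficient of
    \<open>t\<close> is nonzero, some other monomial of \<open>p\<close> in this fibre must
    compensate for it.\<close>
  have "coeff_sum (\<lambda>s. same_image R X A s t) p = 0"
    by (rule coeff_sum_toric_ideal[OF p(1)]) (meson same_image_sym same_image_trans)
  then have "(\<Sum>s\<in>Poly_Mapping.keys p - {t}. if same_image R X A s t then Poly_Mapping.lookup p s else 0) +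
      Poly_Mapping.lookup p t = 0"
    unfolding coeff_sum_def using t by (simp add: sum.remove same_image_refl add.commute)
  moreover have "Poly_Mapping.lookup p t \<noteq> 0" using t by (simp add: in_keys_iff)
  ultimately have "(\<Sum>s\<in>Poly_Mapping.keys p - {t}.
      if same_image R X A s t then Poly_Mapping.lookup p s else 0) \<noteq> 0"
    by auto
  then obtain s where "s \<in> Poly_Mapping.keys p - {t}"
      "(if same_image R X A s t then Poly_Mapping.lookup p s else 0) \<noteq> 0"
    by (rule sum.not_neutral_contains_not_neutral)
  then have "s \<in> Poly_Mapping.keys p" "s \<noteq> t" "same_image R X A s t"
    by (auto split: if_splits)
  then show "nonstandard R X A r t"
    using p(2) t keys unfolding nonstandard_def is_leading_monomial_def by blast
qed

section \<open>Squarefree parts and squarefree initial ideals\<close>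

definition squarefree_part :: "('x \<Rightarrow>\<^sub>0 nat) \<Rightarrow> ('x \<Rightarrow>\<^sub>0 nat)"
  where "squarefree_part t = Poly_Mapping.map (min 1) t"

lemma lookup_squarefree_part [simp]:
  "Poly_Mapping.lookup (squarefree_part t) x = min 1 (Poly_Mapping.lookup t x)"
  by (simp add: squarefree_part_def map.rep_eq when_def)

lemma squarefree_part_mem: "t \<in> monomials X \<Longrightarrow> squarefree_part t \<in> squarefree_monomials X"
  by (auto simp: squarefree_monomials_def monomials_def in_keys_iff subset_iff min_def split: if_splits)

lemma monomials_minus: "t \<in> monomials X \<Longrightarrow> t - s \<in> monomials X"
  by (auto simp: monomials_def subset_iff in_keys_iff lookup_minus)

lemma squarefree_part_split: "t = (t - squarefree_part t) + squarefree_part t"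
  by (rule poly_mapping_eqI) (simp add: lookup_add lookup_minus)

text \<open>Nonstandard monomials are closed under multiples and generate the initial ideal. A
  squarefree generator dividing \<open>t\<close> also divides the squarefree part of
  \<open>t\<close>; conversely, if squarefree parts stay nonstandard, they generate the same
  ideal.\<close>

lemma squarefree_initial_ideal_iff:
  "squarefree_monomial_ideal X
      (initial_ideal X (revlex X r) (toric_ideal R X A :: (('x \<Rightarrow>\<^sub>0 nat) \<Rightarrow>\<^sub>0 'k::field) set)) \<longleftrightarrow>
    (\<forall>t. nonstandard R X A r t \<longrightarrow> nonstandard R X A r (squarefree_part t))"
proof -
  let ?P = "poly_ring X :: (('x \<Rightarrow>\<^sub>0 nat) \<Rightarrow>\<^sub>0 'k::field) ring"
  let ?m = "\<lambda>t. Poly_Mapping.single t 1 :: ('x \<Rightarrow>\<^sub>0 nat) \<Rightarrow>\<^sub>0 'k"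
  let ?N = "{t. nonstandard R X A r t}"
  interpret P: cring ?P by (rule cring_poly_ring)
  have N: "?N \<subseteq> monomials X" by (auto simp: nonstandard_def)
  have carr: "?m ` S \<subseteq> carrier ?P" if "S \<subseteq> monomials X" for S
    using that by (auto simp: carrier_poly_ring)
  have "{?m t |t. \<exists>p \<in> (toric_ideal R X A :: (('x \<Rightarrow>\<^sub>0 nat) \<Rightarrow>\<^sub>0 'k) set). is_leading_monomial (revlex X r) p t} = ?m ` ?N"
    unfolding leading_monomial_toric_ideal_iff by blast
  then have init: "initial_ideal X (revlex X r) (toric_ideal R X A) = Idl\<^bsub>?P\<^esub> (?m ` ?N)"
    by (simp add: initial_ideal_def)
  show ?thesis unfolding init
  proof
    assume "squarefree_monomial_ideal X (Idl\<^bsub>?P\<^esub> (?m ` ?N))"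
    then obtain S where S: "S \<subseteq> squarefree_monomials X" "Idl\<^bsub>?P\<^esub> (?m ` ?N) = Idl\<^bsub>?P\<^esub> (?m ` S)"
      by (auto simp: squarefree_monomial_ideal_def)
    have SX: "S \<subseteq> monomials X" using S by (auto simp: squarefree_monomials_def)
    show "\<forall>t. nonstandard R X A r t \<longrightarrow> nonstandard R X A r (squarefree_part t)"
    proof (intro allI impI)
      fix t assume t: "nonstandard R X A r t"
      then have tX: "t \<in> monomials X" using N by blast
      have "?m t \<in> Idl\<^bsub>?P\<^esub> (?m ` S)"
        using P.genideal_self[OF carr[OF N]] t S(2) by auto
      then obtain s a where s: "s \<in> S" "t = a + s"
        using single_mem_monomial_ideal_iff[OF SX tX] by blast
      have sX: "s \<in> monomials X" using s SX by blast
      \<comment> \<open>A generator lies in the initial ideal, so it is a multiple of a nonstandard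
        monomial and hence nonstandard itself.\<close>
      have "?m s \<in> Idl\<^bsub>?P\<^esub> (?m ` ?N)"
        unfolding S(2) using P.genideal_self[OF carr[OF SX]] s by auto
      then obtain n b where n: "nonstandard R X A r n" "b \<in> monomials X" "s = b + n"
        using single_mem_monomial_ideal_iff[OF N sX] by blast
      then have "nonstandard R X A r s" by (simp add: nonstandard_add)
      \<comment> \<open>The truncated subtraction is exact because \<open>s\<close> is squarefree
        and divides \<open>t\<close>, hence divides the squarefree part.\<close>
      moreover have "squarefree_part t = (squarefree_part t - s) + s"
      proof (rule poly_mapping_eqI)
        fix x
        have "Poly_Mapping.lookup s x \<le> 1" using s S by (auto simp: squarefree_monomials_def)
        then show "Poly_Mapping.lookup (squarefree_part t) x =
            Poly_Mapping.lookup (squarefree_part t - s + s) x"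
          by (simp add: lookup_add lookup_minus s(2) min_def)
      qed
      moreover have "squarefree_part t - s \<in> monomials X"
        using squarefree_part_mem[OF tX] by (simp add: monomials_minus squarefree_monomials_def)
      ultimately show "nonstandard R X A r (squarefree_part t)"
        using nonstandard_add by metis
    qed
  next
    assume *: "\<forall>t. nonstandard R X A r t \<longrightarrow> nonstandard R X A r (squarefree_part t)"
    let ?S = "squarefree_part ` ?N"
    have S: "?S \<subseteq> squarefree_monomials X" using N squarefree_part_mem by blast
    then have SX: "?S \<subseteq> monomials X" by (auto simp: squarefree_monomials_def)
    have "Idl\<^bsub>?P\<^esub> (?m ` ?N) = Idl\<^bsub>?P\<^esub> (?m ` ?S)"
    proof
      have "?m t \<in> Idl\<^bsub>?P\<^esub> (?m ` ?S)" if "t \<in> ?N" for t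
      proof -
        have t: "t \<in> monomials X" using that N by blast
        then show ?thesis
          using single_mem_monomial_ideal_iff[OF SX t] monomials_minus[OF t]
            squarefree_part_split[of t] that by blast
      qed
      then show "Idl\<^bsub>?P\<^esub> (?m ` ?N) \<subseteq> Idl\<^bsub>?P\<^esub> (?m ` ?S)"
        by (intro P.genideal_minimal[OF P.genideal_ideal[OF carr[OF SX]]] image_subsetI)
      show "Idl\<^bsub>?P\<^esub> (?m ` ?S) \<subseteq> Idl\<^bsub>?P\<^esub> (?m ` ?N)"
        by (rule P.subset_Idl_subset[OF carr[OF N]]) (use * in auto)
    qed
    then show "squarefree_monomial_ideal X (Idl\<^bsub>?P\<^esub> (?m ` ?N))"
      using S by (auto simp: squarefree_monomial_ideal_def)
  qed
qed

text \<open>The squarefree part divides \<open>t\<close>. Read contrapositively, squarefree parts of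
  standard monomials are standard.\<close>

lemma nonstandard_squarefree_partD:
  "nonstandard R X A r (squarefree_part t) \<Longrightarrow> t \<in> monomials X \<Longrightarrow> nonstandard R X A r t"
  by (metis monomials_minus nonstandard_add squarefree_part_split)

text \<open>Constant degree on fibres makes each generating binomial homogeneous.\<close>

lemma homogeneous_toric_ideal:
  assumes "\<And>s t. s \<in> monomials X \<Longrightarrow> t \<in> monomials X \<Longrightarrow> same_image R X A s t \<Longrightarrow> monom_deg s = monom_deg t"
  shows "homogeneous_ideal X (toric_ideal R X A :: (('x \<Rightarrow>\<^sub>0 nat) \<Rightarrow>\<^sub>0 'k::field) set)"
proof -
  let ?S = "{Poly_Mapping.single u 1 - Poly_Mapping.single w (1::'k) |u w.
      u \<in> monomials X \<and> w \<in> monomials X \<and> same_image R X A u w}"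
  have "homogeneous_poly p" if p: "p \<in> ?S" for p
  proof -
    obtain u w where uw: "p = Poly_Mapping.single u 1 - Poly_Mapping.single w (1::'k)"
        "monom_deg u = monom_deg w"
      using p assms by blast
    have "\<forall>t\<in>Poly_Mapping.keys p. monom_deg t = monom_deg w"
      using uw by (auto simp: in_keys_iff lookup_minus lookup_single when_def split: if_splits)
    then show ?thesis unfolding homogeneous_poly_def by (rule exI)
  qed
  then show ?thesis
    unfolding homogeneous_ideal_def toric_ideal_def
    by (intro exI[of _ ?S] conjI toric_generators_carrier ballI refl)
qed

section \<open>Existence of standard monomials below nonstandard ones\<close>

lemma finite_monomials_deg:
  assumes "finite X"
  shows "finite {t \<in> monomials X. monom_deg t = n}"
proof (rule finite_imageD)
  show "inj_on Poly_Mapping.lookup {t \<in> monomials X. monom_deg t = n}"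
    by (intro inj_onI poly_mapping_eqI) simp
  \<comment> \<open>Each exponent is bounded by the degree, which leaves finitely many exponent
    functions on \<open>X\<close>.\<close>
  have "Poly_Mapping.lookup t x \<le> n" if "t \<in> monomials X" "monom_deg t = n" "x \<in> X" for t x
  proof -
    have "monom_deg t = (\<Sum>x\<in>X. Poly_Mapping.lookup t x)"
      using that assms by (intro monom_deg_superset) (auto simp: monomials_def)
    moreover have "Poly_Mapping.lookup t x \<le> (\<Sum>x\<in>X. Poly_Mapping.lookup t x)"
      using that assms by (intro member_le_sum) auto
    ultimately show ?thesis using that by simp
  qed
  then have "Poly_Mapping.lookup ` {t \<in> monomials X. monom_deg t = n} \<subseteq>
      {f. \<forall>x. (x \<in> X \<longrightarrow> f x \<in> {..n}) \<and> (x \<notin> X \<longrightarrow> f x = 0)}"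
    by (auto simp: monomials_def in_keys_iff)
  then show "finite (Poly_Mapping.lookup ` {t \<in> monomials X. monom_deg t = n})"
    by (rule finite_subset) (intro finite_set_of_finite_funs assms finite_atMost)
qed

text \<open>The members of the fibre below \<open>u\<close> are finitely many because they share the
  degree of \<open>u\<close>. A minimal one is standard: anything below it in the fibre would by
  transitivity also lie below \<open>u\<close>.\<close>

lemma nonstandard_obtain_standard:
  assumes X: "finite X" and r: "linear_order_on X r"
    and deg: "\<And>s t. s \<in> monomials X \<Longrightarrow> t \<in> monomials X \<Longrightarrow> same_image R X A s t \<Longrightarrow> monom_deg s = monom_deg t"
    and u: "nonstandard R X A r u"
  obtains w where "w \<in> monomials X" "same_image R X A w u" "revlex X r w u" "\<not> nonstandard R X A r w"
proof -
  let ?B = "{s \<in> monomials X. same_image R X A s u \<and> revlex X r s u}"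
  have uX: "u \<in> monomials X" using u by (simp add: nonstandard_def)
  have "?B \<subseteq> {t \<in> monomials X. monom_deg t = monom_deg u}" using uX deg by blast
  then have "finite ?B" using finite_monomials_deg[OF X] finite_subset by blast
  moreover have "?B \<noteq> {}" using u by (auto simp: nonstandard_def)
  moreover have "transp_on ?B (revlex X r)"
    using revlex_trans[OF r] by (blast intro: transp_onI)
  moreover have "asymp_on ?B (revlex X r)"
    using revlex_trans[OF r] revlex_irrefl by (metis asymp_onI)
  ultimately obtain w where w: "w \<in> ?B" "\<forall>s\<in>?B. s \<noteq> w \<longrightarrow> \<not> revlex X r s w"
    using Finite_Set.bex_min_element by (metis (no_types, lifting))
  have "\<not> nonstandard R X A r w"
  proof
    assume "nonstandard R X A r w"
    then obtain s where s: "s \<in> monomials X" "same_image R X A s w" "revlex X r s w"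
      by (auto simp: nonstandard_def)
    then have "s \<in> ?B" using w(1) revlex_trans[OF r] same_image_trans by blast
    then show False using w(2) s(3) revlex_irrefl by metis
  qed
  then show ?thesis using w(1) that by blast
qed

text \<open>Cutting \<open>f\<close> off outside \<open>X\<close> makes the support finite when
  \<open>X\<close> is, so that \<open>Abs_poly_mapping\<close> may be applied.\<close>

definition power_product :: "'x set \<Rightarrow> ('x \<Rightarrow> nat) \<Rightarrow> ('x \<Rightarrow>\<^sub>0 nat)"
  where "power_product X f = Abs_poly_mapping (\<lambda>x. if x \<in> X then f x else 0)"

lemma lookup_power_product:
  assumes "finite X"
  shows "Poly_Mapping.lookup (power_product X f) x = (if x \<in> X then f x else 0)"
proof -
  have "finite {x. (if x \<in> X then f x else 0) \<noteq> 0}"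
    by (rule finite_subset[OF _ assms]) auto
  then show ?thesis by (simp add: power_product_def)
qed

lemma power_product_mem: "finite X \<Longrightarrow> power_product X f \<in> monomials X"
  by (auto simp: monomials_def in_keys_iff lookup_power_product split: if_splits)

lemma lookup_outside: "t \<in> monomials X \<Longrightarrow> x \<notin> X \<Longrightarrow> Poly_Mapping.lookup t x = 0"
  by (auto simp: monomials_def in_keys_iff)

lemma finite_hier_cols: "finite V \<Longrightarrow> finite (hier_cols V d)"
  by (simp add: hier_cols_def finite_PiE)

section \<open>Marginals and links\<close>

text \<open>An exponent vector on the columns is read as a contingency table; this is the entry at
  \<open>e\<close> of its \<open>F\<close>-marginal, as a natural number.\<close>

definition marginal :: "'v set \<Rightarrow> ('v \<Rightarrow> nat) \<Rightarrow> 'v set \<Rightarrow> ('v \<Rightarrow> nat) \<Rightarrow> (('v \<Rightarrow> nat) \<Rightarrow>\<^sub>0 nat) \<Rightarrow> nat"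
  where "marginal V d F e u = (\<Sum>x\<in>{x \<in> hier_cols V d. restrict x F = e}. Poly_Mapping.lookup u x)"

lemma same_image_hier_iff:
  assumes "finite V"
  shows "same_image (hier_rows C d) (hier_cols V d) hier_entry u w \<longleftrightarrow>
    (\<forall>F\<in>facets C. \<forall>e\<in>(\<Pi>\<^sub>E j\<in>F. {1..d j}). marginal V d F e u = marginal V d F e w)"
proof -
  have "(\<Sum>x\<in>hier_cols V d. hier_entry (F, e) x * int (Poly_Mapping.lookup u x)) = int (marginal V d F e u)"
    for F e u
  proof -
    have "(\<Sum>x\<in>hier_cols V d. hier_entry (F, e) x * int (Poly_Mapping.lookup u x)) =
        (\<Sum>x\<in>hier_cols V d. if restrict x F = e then int (Poly_Mapping.lookup u x) else 0)"
      by (rule sum.cong) (auto simp: hier_entry_def)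
    also have "\<dots> = int (marginal V d F e u)"
      unfolding marginal_def of_nat_sum
      by (rule sum.inter_filter[symmetric]) (rule finite_hier_cols[OF assms])
    finally show ?thesis .
  qed
  then show ?thesis
    unfolding same_image_def hier_rows_def by auto
qed

text \<open>The cells are partitioned by their restrictions to \<open>F\<close>, so the entries of a
  single marginal table already add up to the degree. One facet therefore suffices, even the empty
  one.\<close>

lemma same_image_hier_deg:
  assumes V: "finite V" and F: "F \<in> facets C" "F \<subseteq> V"
    and st: "s \<in> monomials (hier_cols V d)" "t \<in> monomials (hier_cols V d)"
      "same_image (hier_rows C d) (hier_cols V d) hier_entry s t"
  shows "monom_deg s = monom_deg t"
proof -
  have "monom_deg u = (\<Sum>e\<in>(\<Pi>\<^sub>E j\<in>F. {1..d j}). marginal V d F e u)"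
    if "u \<in> monomials (hier_cols V d)" for u
  proof -
    have "monom_deg u = (\<Sum>x\<in>hier_cols V d. Poly_Mapping.lookup u x)"
      using that finite_hier_cols[OF V] by (intro monom_deg_superset) (auto simp: monomials_def)
    also have "\<dots> = (\<Sum>e\<in>(\<Pi>\<^sub>E j\<in>F. {1..d j}). marginal V d F e u)"
      unfolding marginal_def
    proof (rule sum.group[symmetric])
      show "finite (\<Pi>\<^sub>E j\<in>F. {1..d j})"
        using F(2) V by (intro finite_PiE) (auto intro: finite_subset)
      show "(\<lambda>x. restrict x F) ` hier_cols V d \<subseteq> (\<Pi>\<^sub>E j\<in>F. {1..d j})"
        using F(2) by (fastforce simp: hier_cols_def PiE_iff)
    qed (rule finite_hier_cols[OF V])
    finally show ?thesis .
  qed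
  moreover have "marginal V d F e s = marginal V d F e t" if "e \<in> (\<Pi>\<^sub>E j\<in>F. {1..d j})" for e
    using st(3) F(1) that by (simp add: same_image_hier_iff[OF V])
  ultimately show ?thesis using st by simp
qed

text \<open>Deleting \<open>v\<close> preserves and reflects inclusion among the members of
  \<open>C\<close> that contain \<open>v\<close>, and every member above such a one contains
  \<open>v\<close> as well. So maximality means the same on both sides.\<close>

lemma facets_link: "facets (link v C) = {F - {v} |F. F \<in> facets C \<and> v \<in> F}"
proof
  show "facets (link v C) \<subseteq> {F - {v} |F. F \<in> facets C \<and> v \<in> F}"
  proof
    fix H assume H: "H \<in> facets (link v C)"
    then obtain F where F: "F \<in> C" "v \<in> F" "H = F - {v}"
      by (auto simp: facets_def link_def)
    have "G = F" if "G \<in> C" "F \<subseteq> G" for G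
    proof -
      have "G - {v} \<in> link v C" using that F by (auto simp: link_def)
      then have "G - {v} = F - {v}" using H F that by (auto simp: facets_def)
      then show ?thesis using F that by blast
    qed
    then show "H \<in> {F - {v} |F. F \<in> facets C \<and> v \<in> F}"
      using F by (auto simp: facets_def)
  qed
  show "{F - {v} |F. F \<in> facets C \<and> v \<in> F} \<subseteq> facets (link v C)"
    by (fastforce simp: facets_def link_def)
qed

lemma facets_nonempty:
  assumes "finite C" "F \<in> C"
  obtains G where "G \<in> facets C" "F \<subseteq> G"
proof -
  obtain G where G: "G \<in> C" "F \<subseteq> G" "\<forall>H\<in>C. G \<subseteq> H \<longrightarrow> G = H"
    using finite_has_maximal2[OF assms] by metis
  then have "G \<in> facets C" by (auto simp: facets_def)
  then show ?thesis using G(2) by (rule that)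
qed

lemma hier_cols_restrict_self: "x \<in> hier_cols V d \<Longrightarrow> restrict x V = x"
  by (simp add: hier_cols_def)

lemma hier_cols_update:
  assumes "v \<in> V" "i \<in> hier_cols (V - {v}) d" "k \<in> {1..d v}"
  shows "i(v := k) \<in> hier_cols V d"
  using assms by (auto simp: hier_cols_def PiE_iff extensional_def)

lemma hier_cols_restrict:
  assumes "x \<in> hier_cols V d"
  shows "restrict x (V - {v}) \<in> hier_cols (V - {v}) d"
  using assms by (auto simp: hier_cols_def PiE_iff)

lemma hier_cols_restrict_update:
  assumes "x \<in> hier_cols V d" "v \<in> V"
  shows "(restrict x (V - {v}))(v := x v) = x"
  using assms by (auto simp: hier_cols_def PiE_iff extensional_def restrict_def)

lemma hier_cols_update_restrict:
  assumes "i \<in> hier_cols (V - {v}) d"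
  shows "restrict (i(v := k)) (V - {v}) = i"
  using assms by (auto simp: hier_cols_def PiE_iff extensional_def restrict_def)

lemma hier_cols_level: "x \<in> hier_cols V d \<Longrightarrow> v \<in> V \<Longrightarrow> x v \<in> {1..d v}"
  by (auto simp: hier_cols_def PiE_iff)

text \<open>All cells that restrict to \<open>e\<close> on \<open>F\<close> lie on level
  \<open>e v\<close>; forgetting the coordinate \<open>v\<close> is a bijection onto the cells
  summed on the right.\<close>

lemma marginal_vertex:
  assumes v: "v \<in> V" "v \<in> F" and F: "F \<subseteq> V" and e: "e \<in> (\<Pi>\<^sub>E j\<in>F. {1..d j})"
  shows "marginal V d F e u =
    (\<Sum>i\<in>{i \<in> hier_cols (V - {v}) d. restrict i (F - {v}) = restrict e (F - {v})}.
      Poly_Mapping.lookup u (i(v := e v)))"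
  unfolding marginal_def
proof (rule sum.reindex_bij_witness[where i = "\<lambda>i. i(v := e v)" and j = "\<lambda>x. restrict x (V - {v})"])
  fix x assume x: "x \<in> {x \<in> hier_cols V d. restrict x F = e}"
  then have xv: "x v = e v" using v by auto
  then show "(restrict x (V - {v}))(v := e v) = x"
    using x v hier_cols_restrict_update[of x V d v] by simp
  then show "Poly_Mapping.lookup u ((restrict x (V - {v}))(v := e v)) = Poly_Mapping.lookup u x"
    by simp
  have "restrict (restrict x (V - {v})) (F - {v}) = restrict e (F - {v})"
  proof -
    have "(V - {v}) \<inter> (F - {v}) = F \<inter> (F - {v})" using F by blast
    moreover have "e = restrict x F" using x by simp
    ultimately show ?thesis by (simp only: restrict_restrict)
  qed
  then show "restrict x (V - {v}) \<in> {i \<in> hier_cols (V - {v}) d. restrict i (F - {v}) = restrict e (F - {v})}"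
    using x by (simp add: hier_cols_restrict)
next
  fix i assume i: "i \<in> {i \<in> hier_cols (V - {v}) d. restrict i (F - {v}) = restrict e (F - {v})}"
  then show "restrict (i(v := e v)) (V - {v}) = i"
    by (intro hier_cols_update_restrict) auto
  have "restrict (i(v := e v)) F = e"
  proof
    fix j
    show "restrict (i(v := e v)) F j = e j"
    proof (cases "j \<in> F - {v}")
      case True
      then have "i j = e j" using i by (metis (mono_tags, lifting) mem_Collect_eq restrict_apply')
      then show ?thesis using True by simp
    next
      case False
      then show ?thesis using e v by (auto simp: PiE_iff extensional_def)
    qed
  qed
  moreover have "i(v := e v) \<in> hier_cols V d"
    using i e v by (intro hier_cols_update) auto
  ultimately show "i(v := e v) \<in> {x \<in> hier_cols V d. restrict x F = e}" by simp
qed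

text \<open>Here \<open>F\<close> does not see the coordinate \<open>v\<close>, so the cells split
  as pairs of a smaller cell and an arbitrary level.\<close>

lemma marginal_nonvertex:
  assumes V: "finite V" and v: "v \<in> V" "v \<notin> F" and F: "F \<subseteq> V"
  shows "marginal V d F e u =
    (\<Sum>i\<in>{i \<in> hier_cols (V - {v}) d. restrict i F = e}. \<Sum>k\<in>{1..d v}. Poly_Mapping.lookup u (i(v := k)))"
proof -
  have eq: "restrict (restrict x (V - {v})) F = restrict x F" for x :: "'a \<Rightarrow> nat"
    using v F by (auto simp: restrict_def fun_eq_iff)
  have eq': "restrict (i(v := k)) F = restrict i F" for i :: "'a \<Rightarrow> nat" and k
    using v by (auto simp: restrict_def fun_eq_iff)
  have "marginal V d F e u =
    (\<Sum>(i, k)\<in>{i \<in> hier_cols (V - {v}) d. restrict i F = e} \<times> {1..d v}. Poly_Mapping.lookup u (i(v := k)))"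
    unfolding marginal_def
  proof (rule sum.reindex_bij_witness[where i = "\<lambda>(i, k). i(v := k)" and j = "\<lambda>x. (restrict x (V - {v}), x v)"])
    fix x assume "x \<in> {x \<in> hier_cols V d. restrict x F = e}"
    then have x: "x \<in> hier_cols V d" "restrict x F = e" by auto
    note upd = hier_cols_restrict_update[OF x(1) v(1)]
    show "(case (restrict x (V - {v}), x v) of (i, k) \<Rightarrow> i(v := k)) = x"
      by (simp only: prod.case upd)
    show "(restrict x (V - {v}), x v) \<in> {i \<in> hier_cols (V - {v}) d. restrict i F = e} \<times> {1..d v}"
      using hier_cols_restrict[OF x(1)] hier_cols_level[OF x(1) v(1)] x(2) eq[of x] by simp
    show "(case (restrict x (V - {v}), x v) of (i, k) \<Rightarrow> Poly_Mapping.lookup u (i(v := k))) = Poly_Mapping.lookup u x"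
      by (simp only: prod.case upd)
  next
    fix p assume "p \<in> {i \<in> hier_cols (V - {v}) d. restrict i F = e} \<times> {1..d v}"
    then obtain i k where p: "p = (i, k)" "i \<in> hier_cols (V - {v}) d" "restrict i F = e" "k \<in> {1..d v}"
      by auto
    show "(restrict (case p of (i, k) \<Rightarrow> i(v := k)) (V - {v}), (case p of (i, k) \<Rightarrow> i(v := k)) v) = p"
      by (simp only: p(1) prod.case hier_cols_update_restrict[OF p(2)] fun_upd_same)
    show "(case p of (i, k) \<Rightarrow> i(v := k)) \<in> {x \<in> hier_cols V d. restrict x F = e}"
      using hier_cols_update[OF v(1) p(2,4)] p(1,3) eq'[of i k] by simp
  qed
  then show ?thesis by (simp add: sum.cartesian_product)
qed

section \<open>Slicing and stacking along a vertex\<close>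

definition slice :: "'v set \<Rightarrow> ('v \<Rightarrow> nat) \<Rightarrow> 'v \<Rightarrow> nat \<Rightarrow> (('v \<Rightarrow> nat) \<Rightarrow>\<^sub>0 nat) \<Rightarrow> (('v \<Rightarrow> nat) \<Rightarrow>\<^sub>0 nat)"
  where "slice V d v k u = power_product (hier_cols (V - {v}) d) (\<lambda>i. Poly_Mapping.lookup u (i(v := k)))"

text \<open>Levels are numbered from 1. Any levels above 2 are left empty, so that the same
  construction serves every \<open>d v\<close> that is at least 2.\<close>

definition stack :: "'v set \<Rightarrow> ('v \<Rightarrow> nat) \<Rightarrow> 'v \<Rightarrow> (('v \<Rightarrow> nat) \<Rightarrow>\<^sub>0 nat) \<Rightarrow> (('v \<Rightarrow> nat) \<Rightarrow>\<^sub>0 nat) \<Rightarrow> (('v \<Rightarrow> nat) \<Rightarrow>\<^sub>0 nat)"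
  where "stack V d v u w = power_product (hier_cols V d)
    (\<lambda>x. if x v = 1 then Poly_Mapping.lookup u (restrict x (V - {v}))
      else if x v = 2 then Poly_Mapping.lookup w (restrict x (V - {v})) else 0)"

context
  fixes V :: "'v set" and d :: "'v \<Rightarrow> nat" and v :: 'v
  assumes V: "finite V" and v: "v \<in> V"
begin

lemma lookup_slice:
  "i \<in> hier_cols (V - {v}) d \<Longrightarrow>
    Poly_Mapping.lookup (slice V d v k u) i = Poly_Mapping.lookup u (i(v := k))"
  using V by (simp add: slice_def lookup_power_product finite_hier_cols)

lemma slice_mem: "slice V d v k u \<in> monomials (hier_cols (V - {v}) d)"
  using V by (simp add: slice_def power_product_mem finite_hier_cols)

lemma stack_mem: "stack V d v u w \<in> monomials (hier_cols V d)"
  using V by (simp add: stack_def power_product_mem finite_hier_cols)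

lemma lookup_stack:
  "x \<in> hier_cols V d \<Longrightarrow> Poly_Mapping.lookup (stack V d v u w) x =
    (if x v = 1 then Poly_Mapping.lookup u (restrict x (V - {v}))
      else if x v = 2 then Poly_Mapping.lookup w (restrict x (V - {v})) else 0)"
  using V by (simp add: stack_def lookup_power_product finite_hier_cols)

lemma lookup_stack_update:
  assumes "i \<in> hier_cols (V - {v}) d" "k \<in> {1..d v}"
  shows "Poly_Mapping.lookup (stack V d v u w) (i(v := k)) =
    (if k = 1 then Poly_Mapping.lookup u i else if k = 2 then Poly_Mapping.lookup w i else 0)"
  using assms by (simp add: lookup_stack hier_cols_update[OF v] hier_cols_restrict_self)

lemma slice_stack:
  assumes "u \<in> monomials (hier_cols (V - {v}) d)" "w \<in> monomials (hier_cols (V - {v}) d)" "k \<in> {1..d v}"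
  shows "slice V d v k (stack V d v u w) = (if k = 1 then u else if k = 2 then w else 0)"
proof (rule poly_mapping_eqI)
  fix i
  show "Poly_Mapping.lookup (slice V d v k (stack V d v u w)) i =
      Poly_Mapping.lookup (if k = 1 then u else if k = 2 then w else 0) i"
  proof (cases "i \<in> hier_cols (V - {v}) d")
    case True
    then show ?thesis using assms by (simp add: lookup_slice lookup_stack_update)
  next
    case False
    then show ?thesis using lookup_outside[OF _ False] assms slice_mem by auto
  qed
qed

lemma squarefree_part_stack:
  "squarefree_part (stack V d v u w) = stack V d v (squarefree_part u) (squarefree_part w)"
proof (rule poly_mapping_eqI)
  fix x
  show "Poly_Mapping.lookup (squarefree_part (stack V d v u w)) x =
      Poly_Mapping.lookup (stack V d v (squarefree_part u) (squarefree_part w)) x"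
    by (cases "x \<in> hier_cols V d") (simp_all add: lookup_stack lookup_outside[OF stack_mem])
qed

text \<open>A facet of the link is \<open>F - {v}\<close> for a facet \<open>F\<close> through
  \<open>v\<close>, and its marginal of the slice at level \<open>k\<close> is part of the
  \<open>F\<close>-marginal of the whole table.\<close>

lemma same_image_slice:
  assumes C: "C \<subseteq> Pow V"
    and st: "same_image (hier_rows C d) (hier_cols V d) hier_entry s t" and k: "k \<in> {1..d v}"
  shows "same_image (hier_rows (link v C) d) (hier_cols (V - {v}) d) hier_entry (slice V d v k s) (slice V d v k t)"
  unfolding same_image_hier_iff[OF finite_Diff[OF V]] facets_link
proof (intro ballI)
  fix H e assume H: "H \<in> {F - {v} |F. F \<in> facets C \<and> v \<in> F}" and e: "e \<in> (\<Pi>\<^sub>E j\<in>H. {1..d j})"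
  from H obtain F where F: "F \<in> facets C" "v \<in> F" "H = F - {v}" by blast
  have FV: "F \<subseteq> V" using F C by (auto simp: facets_def)
  let ?e = "e(v := k)"
  have e': "?e \<in> (\<Pi>\<^sub>E j\<in>F. {1..d j})"
    using e F k by (auto simp: PiE_iff extensional_def)
  have re: "restrict ?e (F - {v}) = e"
    using e F by (auto simp: PiE_iff extensional_def restrict_def fun_eq_iff)
  have "marginal (V - {v}) d H e (slice V d v k u) = marginal V d F ?e u" for u
    unfolding marginal_vertex[OF v F(2) FV e'] re unfolding marginal_def F(3)
    by (rule sum.cong) (auto simp: lookup_slice)
  moreover have "marginal V d F ?e s = marginal V d F ?e t"
    using st F(1) e' by (simp add: same_image_hier_iff[OF V])
  ultimately show "marginal (V - {v}) d H e (slice V d v k s) = marginal (V - {v}) d H e (slice V d v k t)"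
    by simp
qed

text \<open>A facet through \<open>v\<close> sees one level at a time. On levels 1 and 2 it compares
  the marginals of \<open>u\<close> and \<open>w\<close> for a facet of the link, which agree; the
  other levels are zero. A facet avoiding \<open>v\<close> sees \<open>u + w\<close>, which is
  symmetric.\<close>

lemma same_image_stack:
  assumes C: "C \<subseteq> Pow V" and dv: "d v \<ge> 2"
    and uw: "same_image (hier_rows (link v C) d) (hier_cols (V - {v}) d) hier_entry u w"
  shows "same_image (hier_rows C d) (hier_cols V d) hier_entry (stack V d v u w) (stack V d v w u)"
  unfolding same_image_hier_iff[OF V]
proof (intro ballI)
  fix F e assume F: "F \<in> facets C" and e: "e \<in> (\<Pi>\<^sub>E j\<in>F. {1..d j})"
  have FV: "F \<subseteq> V" using F C by (auto simp: facets_def)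
  show "marginal V d F e (stack V d v u w) = marginal V d F e (stack V d v w u)"
  proof (cases "v \<in> F")
    case True
    let ?H = "F - {v}"
    have "?H \<in> facets (link v C)" using F True by (auto simp: facets_link)
    moreover have "restrict e ?H \<in> (\<Pi>\<^sub>E j\<in>?H. {1..d j})"
      using e by (auto simp: PiE_iff)
    ultimately have eq: "marginal (V - {v}) d ?H (restrict e ?H) u = marginal (V - {v}) d ?H (restrict e ?H) w"
      using uw by (simp add: same_image_hier_iff[OF finite_Diff[OF V]])
    have ev: "e v \<in> {1..d v}" using e True by auto
    have "marginal V d F e (stack V d v a b) = (if e v = 1 then marginal (V - {v}) d ?H (restrict e ?H) a
        else if e v = 2 then marginal (V - {v}) d ?H (restrict e ?H) b else 0)" for a b
      unfolding marginal_vertex[OF v True FV e] unfolding marginal_def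
      using ev by (simp add: lookup_stack_update)
    then show ?thesis using eq by simp
  next
    case False
    have "(\<Sum>k\<in>{1..d v}. Poly_Mapping.lookup (stack V d v a b) (i(v := k))) =
        Poly_Mapping.lookup a i + Poly_Mapping.lookup b i" if i: "i \<in> hier_cols (V - {v}) d" for i a b
    proof -
      \<comment> \<open>Both levels 1 and 2 exist because \<open>d v\<close> is at least 2, and only
        they carry nonzero entries.\<close>
      have "(\<Sum>k\<in>{1..d v}. Poly_Mapping.lookup (stack V d v a b) (i(v := k))) =
          (\<Sum>k\<in>{1, 2}. Poly_Mapping.lookup (stack V d v a b) (i(v := k)))"
        using dv i by (intro sum.mono_neutral_right) (auto simp: lookup_stack_update)
      also have "\<dots> = Poly_Mapping.lookup a i + Poly_Mapping.lookup b i"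
        using dv i by (simp add: lookup_stack_update)
      finally show ?thesis .
    qed
    then show ?thesis
      by (simp add: marginal_nonvertex[OF V v False FV] add.commute)
  qed
qed

text \<open>The lexicographic order on pairs of a level and a smaller cell, pulled back to the
  cells. Lower levels hold the smaller variables, so revlex inspects level 1 completely before level
  2, and each level in the order \<open>r\<close>.\<close>

definition level_lex :: "('v \<Rightarrow> nat) rel \<Rightarrow> ('v \<Rightarrow> nat) rel"
  where "level_lex r = {(x, y). x \<in> hier_cols V d \<and> y \<in> hier_cols V d \<and>
    (x v < y v \<or> x v = y v \<and> (restrict x (V - {v}), restrict y (V - {v})) \<in> r)}"

text \<open>A cell is determined by its level and its restriction, so antisymmetry and totality
  carry over from the lexicographic order.\<close>

lemma linear_order_level_lex:
  assumes r: "linear_order_on (hier_cols (V - {v}) d) r"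
  shows "linear_order_on (hier_cols V d) (level_lex r)"
proof -
  have tr: "trans r" and an: "antisym r" and tot: "total_on (hier_cols (V - {v}) d) r"
    and re: "refl_on (hier_cols (V - {v}) d) r"
    using r by (auto simp: linear_order_on_def partial_order_on_def preorder_on_def)
  have inj: "x = y" if "x \<in> hier_cols V d" "y \<in> hier_cols V d" "x v = y v"
      "restrict x (V - {v}) = restrict y (V - {v})" for x y
    using that hier_cols_restrict_update[OF _ v] by metis
  have "refl_on (hier_cols V d) (level_lex r)"
  proof (rule refl_onI)
    fix x assume x: "x \<in> hier_cols V d"
    then have "(restrict x (V - {v}), restrict x (V - {v})) \<in> r"
      using re hier_cols_restrict by (metis refl_onD)
    then show "(x, x) \<in> level_lex r" using x by (simp add: level_lex_def)
  qed
  moreover have "trans (level_lex r)"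
    by (rule transI) (use tr in \<open>auto simp: level_lex_def dest: transD\<close>)
  moreover have "antisym (level_lex r)"
    by (rule antisymI) (use an inj in \<open>auto simp: level_lex_def dest: antisymD\<close>)
  moreover have "total_on (hier_cols V d) (level_lex r)"
    unfolding total_on_def
  proof (intro ballI impI)
    fix x y assume xy: "x \<in> hier_cols V d" "y \<in> hier_cols V d" "x \<noteq> y"
    consider "x v < y v" | "y v < x v" | "x v = y v" "restrict x (V - {v}) \<noteq> restrict y (V - {v})"
      using xy inj by (metis nat_neq_iff)
    then show "(x, y) \<in> level_lex r \<or> (y, x) \<in> level_lex r"
    proof cases
      case 3
      then have "(restrict x (V - {v}), restrict y (V - {v})) \<in> r \<or> (restrict y (V - {v}), restrict x (V - {v})) \<in> r"
        using tot hier_cols_restrict[OF xy(1)] hier_cols_restrict[OF xy(2)] by (auto simp: total_on_def)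
      then show ?thesis using 3 xy by (auto simp: level_lex_def)
    qed (use xy in \<open>auto simp: level_lex_def\<close>)
  qed
  moreover have "level_lex r \<subseteq> hier_cols V d \<times> hier_cols V d"
    by (auto simp: level_lex_def)
  ultimately show ?thesis
    by (simp add: linear_order_on_def partial_order_on_def preorder_on_def)
qed

text \<open>The variable that decides between \<open>w\<close> and \<open>u\<close>, placed on level
  1, decides between the stacks, since their first levels are \<open>w\<close> and
  \<open>u\<close>.\<close>

lemma revlex_stack:
  assumes dv: "d v \<ge> 2" and deg: "monom_deg (stack V d v w u) = monom_deg (stack V d v u w)"
    and deg': "monom_deg w = monom_deg u"
    and wu: "revlex (hier_cols (V - {v}) d) r w u"
  shows "revlex (hier_cols V d) (level_lex r) (stack V d v w u) (stack V d v u w)"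
proof -
  obtain i where i: "i \<in> hier_cols (V - {v}) d" "Poly_Mapping.lookup w i > Poly_Mapping.lookup u i"
      "\<And>j. j \<in> hier_cols (V - {v}) d \<Longrightarrow> (j, i) \<in> r \<Longrightarrow> j \<noteq> i \<Longrightarrow> Poly_Mapping.lookup w j = Poly_Mapping.lookup u j"
    using wu deg' by (auto simp: revlex_def)
  let ?x = "i(v := 1)"
  have one: "1 \<in> {1..d v}" using dv by simp
  have x: "?x \<in> hier_cols V d" using i one by (intro hier_cols_update v)
  have "Poly_Mapping.lookup (stack V d v w u) y = Poly_Mapping.lookup (stack V d v u w) y"
    if y: "y \<in> hier_cols V d" "(y, ?x) \<in> level_lex r" "y \<noteq> ?x" for y
  proof -
    \<comment> \<open>No level precedes level 1, so every variable below \<open>?x\<close> lies on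
      level 1 too.\<close>
    have "y v \<ge> 1" using hier_cols_level[OF y(1) v] by simp
    then have yv: "y v = 1" and yr: "(restrict y (V - {v}), i) \<in> r"
      using y i(1) by (auto simp: level_lex_def hier_cols_restrict_self)
    have "restrict y (V - {v}) \<noteq> i"
      using y yv hier_cols_restrict_update[OF y(1) v] by auto
    then show ?thesis
      using i(3)[OF hier_cols_restrict[OF y(1)] yr] y yv by (simp add: lookup_stack)
  qed
  then show ?thesis
    unfolding revlex_def using deg x i one by (auto simp: lookup_stack_update intro!: bexI[of _ ?x])
qed

text \<open>Here \<open>k\<close> is the level of the deciding variable. Slices need not have equal
  degrees in general, so this is left as a premise; it will come from a common fibre of the link.
  The deciding exponent in \<open>s\<close> is positive, so its slice is nonzero, which later
  excludes the empty levels of a stack.\<close>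

lemma revlex_slice:
  assumes lt: "revlex (hier_cols V d) (level_lex r) s t" and deg: "monom_deg s = monom_deg t"
  obtains k where "k \<in> {1..d v}"
    "monom_deg (slice V d v k s) = monom_deg (slice V d v k t) \<Longrightarrow>
      revlex (hier_cols (V - {v}) d) r (slice V d v k s) (slice V d v k t)"
    "slice V d v k s \<noteq> 0"
proof -
  obtain x where x: "x \<in> hier_cols V d" "Poly_Mapping.lookup s x > Poly_Mapping.lookup t x"
    "\<And>y. y \<in> hier_cols V d \<Longrightarrow> (y, x) \<in> level_lex r \<Longrightarrow> y \<noteq> x \<Longrightarrow> Poly_Mapping.lookup s y = Poly_Mapping.lookup t y"
    using lt deg by (auto simp: revlex_def)
  let ?i = "restrict x (V - {v})" and ?k = "x v"
  have i: "?i \<in> hier_cols (V - {v}) d" by (rule hier_cols_restrict[OF x(1)])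
  have k: "?k \<in> {1..d v}" by (rule hier_cols_level[OF x(1) v])
  have xi: "?i(v := ?k) = x" by (rule hier_cols_restrict_update[OF x(1) v])
  have gt: "Poly_Mapping.lookup (slice V d v ?k s) ?i > Poly_Mapping.lookup (slice V d v ?k t) ?i"
    using x(2) by (simp add: lookup_slice[OF i] xi)
  have "Poly_Mapping.lookup (slice V d v ?k s) j = Poly_Mapping.lookup (slice V d v ?k t) j"
    if j: "j \<in> hier_cols (V - {v}) d" "(j, ?i) \<in> r" "j \<noteq> ?i" for j
  proof -
    have y: "j(v := ?k) \<in> hier_cols V d" by (rule hier_cols_update[OF v j(1) k])
    have "j(v := ?k) \<noteq> x" using hier_cols_update_restrict[OF j(1)] j(3) by metis
    moreover have "(j(v := ?k), x) \<in> level_lex r"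
      using y x(1) j by (simp add: level_lex_def hier_cols_restrict_self)
    ultimately show ?thesis using x(3)[OF y] by (simp add: lookup_slice[OF j(1)])
  qed
  then have "revlex (hier_cols (V - {v}) d) r (slice V d v ?k s) (slice V d v ?k t)"
    if "monom_deg (slice V d v ?k s) = monom_deg (slice V d v ?k t)"
    unfolding revlex_def using that gt i by blast
  moreover have "slice V d v ?k s \<noteq> 0" using gt by auto
  ultimately show ?thesis using that k by blast
qed

section \<open>Transfer of the squarefree condition to the link\<close>

lemma nonstandard_link_squarefree:
  assumes C: "C \<subseteq> Pow V" "{v} \<in> C" and dv: "d v \<ge> 2"
    and r: "linear_order_on (hier_cols (V - {v}) d) r"
    and sqf: "\<And>t. nonstandard (hier_rows C d) (hier_cols V d) hier_entry (level_lex r) t \<Longrightarrow>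
      nonstandard (hier_rows C d) (hier_cols V d) hier_entry (level_lex r) (squarefree_part t)"
    and u: "nonstandard (hier_rows (link v C) d) (hier_cols (V - {v}) d) hier_entry r u"
  shows "nonstandard (hier_rows (link v C) d) (hier_cols (V - {v}) d) hier_entry r (squarefree_part u)"
proof -
  let ?X = "hier_cols V d" and ?Y = "hier_cols (V - {v}) d"
  let ?si = "same_image (hier_rows C d) ?X hier_entry"
  let ?sl = "same_image (hier_rows (link v C) d) ?Y hier_entry"
  let ?nl = "nonstandard (hier_rows (link v C) d) ?Y hier_entry r"
  have finC: "finite C" using C V by (meson finite_Pow_iff finite_subset)
  \<comment> \<open>A facet through \<open>v\<close> fixes the degree on fibres of \<open>C\<close>,
    and without \<open>v\<close> it is a facet of the link, which fixes the degree there.\<close>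
  obtain F where F: "F \<in> facets C" "{v} \<subseteq> F" using facets_nonempty[OF finC C(2)] by blast
  have FV: "F \<subseteq> V" using F C by (auto simp: facets_def)
  have FL: "F - {v} \<in> facets (link v C)" using F by (auto simp: facets_link)
  note deg = same_image_hier_deg[OF V F(1) FV, where d = d]
  have degl: "monom_deg s = monom_deg t" if "s \<in> monomials ?Y" "t \<in> monomials ?Y" "?sl s t" for s t
    using same_image_hier_deg[OF finite_Diff[OF V] FL Diff_mono[OF FV subset_refl]] that by blast
  have uY: "u \<in> monomials ?Y" using u by (simp add: nonstandard_def)
  obtain w where w: "w \<in> monomials ?Y" "?sl w u" "revlex ?Y r w u" "\<not> ?nl w"
    using nonstandard_obtain_standard[OF finite_hier_cols[OF finite_Diff[OF V]] r degl u] by blast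
  have si: "?si (stack V d v w u) (stack V d v u w)"
    by (rule same_image_stack[OF C(1) dv w(2)])
  have "revlex ?X (level_lex r) (stack V d v w u) (stack V d v u w)"
    by (rule revlex_stack[OF dv deg[OF stack_mem stack_mem si] degl[OF w(1) uY w(2)] w(3)])
  then have "nonstandard (hier_rows C d) ?X hier_entry (level_lex r) (stack V d v u w)"
    using si stack_mem unfolding nonstandard_def by blast
  then have "nonstandard (hier_rows C d) ?X hier_entry (level_lex r)
      (stack V d v (squarefree_part u) (squarefree_part w))"
    unfolding squarefree_part_stack[symmetric] by (rule sqf)
  then obtain s where s: "s \<in> monomials ?X" "?si s (stack V d v (squarefree_part u) (squarefree_part w))"
      "revlex ?X (level_lex r) s (stack V d v (squarefree_part u) (squarefree_part w))"
    by (auto simp: nonstandard_def)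
  have sq: "squarefree_part u \<in> monomials ?Y" "squarefree_part w \<in> monomials ?Y"
    using squarefree_part_mem[OF uY] squarefree_part_mem[OF w(1)] by (auto simp: squarefree_monomials_def)
  obtain k where k: "k \<in> {1..d v}"
      "monom_deg (slice V d v k s) = monom_deg (slice V d v k (stack V d v (squarefree_part u) (squarefree_part w))) \<Longrightarrow>
        revlex ?Y r (slice V d v k s) (slice V d v k (stack V d v (squarefree_part u) (squarefree_part w)))"
      "slice V d v k s \<noteq> 0"
    using revlex_slice[OF s(3) deg[OF s(1) stack_mem s(2)]] by blast
  have sk: "?sl (slice V d v k s) (slice V d v k (stack V d v (squarefree_part u) (squarefree_part w)))"
    by (rule same_image_slice[OF C(1) s(2) k(1)])
  have degk: "monom_deg (slice V d v k s) =
      monom_deg (slice V d v k (stack V d v (squarefree_part u) (squarefree_part w)))"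
    by (rule degl[OF slice_mem slice_mem sk])
  have nk: "?nl (slice V d v k (stack V d v (squarefree_part u) (squarefree_part w)))"
    using slice_mem sk k(2)[OF degk] unfolding nonstandard_def by blast
  \<comment> \<open>On level 1 the slice of the squarefree stack is the squarefree part of
    \<open>u\<close>, as wanted. Level 2 would make the squarefree part of the standard
    \<open>w\<close> nonstandard.\<close>
  consider "k = 1" | "k = 2" | "k \<noteq> 1" "k \<noteq> 2" by blast
  then show ?thesis
  proof cases
    case 1
    then show ?thesis using nk k(1) by (simp add: slice_stack[OF sq])
  next
    case 2
    then have "?nl (squarefree_part w)" using nk k(1) by (simp add: slice_stack[OF sq])
    then have "?nl w" using w(1) by (rule nonstandard_squarefree_partD)
    then show ?thesis using w(4) by blast
  next
    case 3
    \<comment> \<open>The stack is empty on this level, and equality of degrees empties the slice of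
      \<open>s\<close> as well, against the choice of \<open>k\<close>.\<close>
    then have "monom_deg (slice V d v k s) = 0"
      using degk k(1) by (simp add: slice_stack[OF sq] monom_deg_def)
    then have "slice V d v k s = 0"
      by (simp add: monom_deg_def in_keys_iff poly_mapping_eqI)
    then show ?thesis using k(3) by blast
  qed
qed

end

text \<open>The levels of the link are \<open>d\<close> restricted to the smaller ground set.
  Columns, and likewise rows, consult \<open>d\<close> only there, so the argument can keep the
  original \<open>d\<close>.\<close>

lemma hier_cols_restrict_levels: "hier_cols V (restrict d V) = hier_cols V d"
  unfolding hier_cols_def by (rule PiE_cong) simp

lemma hier_rows_restrict_levels:
  assumes "C \<subseteq> Pow V"
  shows "hier_rows C (restrict d V) = hier_rows C d"
  unfolding hier_rows_def
proof (rule Sigma_cong)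
  fix F assume "F \<in> facets C"
  then have "F \<subseteq> V" using assms by (auto simp: facets_def)
  then show "(\<Pi>\<^sub>E j\<in>F. {1..restrict d V j}) = (\<Pi>\<^sub>E j\<in>F. {1..d j})"
    by (intro PiE_cong) auto
qed simp

theorem theorem6p7:
  fixes m v :: nat and C :: "nat set set" and d :: "nat \<Rightarrow> nat"
  assumes "simplicial_complex {1..m} C"
    and "\<forall>j\<in>{1..m}. d j \<ge> 2"
    and "hier_compressed TYPE('k::field) {1..m} C d"
    and "{v} \<in> C"
  shows "hier_compressed TYPE('k) ({1..m} - {v}) (link v C) (restrict d ({1..m} - {v}))"
proof -
  let ?V = "{1..m}"
  have V: "finite ?V" by simp
  have C: "C \<subseteq> Pow ?V" using assms(1) by (simp add: simplicial_complex_def)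
  have v: "v \<in> ?V" using C assms(4) by auto
  have dv: "d v \<ge> 2" using assms(2) v by simp
  have link: "link v C \<subseteq> Pow (?V - {v})" using C by (auto simp: link_def)
  have "finite (link v C)" using link by (meson V finite_Diff finite_Pow_iff finite_subset)
  \<comment> \<open>As \<open>{v}\<close> is a face, the link contains the empty face and so has at
    least one facet; its marginals make the toric ideal homogeneous.\<close>
  moreover have "{v} - {v} \<in> link v C" using assms(4) unfolding link_def by blast
  ultimately obtain F where F: "F \<in> facets (link v C)" by (rule facets_nonempty)
  have FV: "F \<subseteq> ?V - {v}" using F link by (auto simp: facets_def)
  have "homogeneous_ideal (hier_cols (?V - {v}) d)
      (toric_ideal (hier_rows (link v C) d) (hier_cols (?V - {v}) d) hier_entry :: (_ \<Rightarrow>\<^sub>0 'k) set)"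
    by (rule homogeneous_toric_ideal) (rule same_image_hier_deg[OF finite_Diff[OF V] F FV])
  moreover have "nonstandard (hier_rows (link v C) d) (hier_cols (?V - {v}) d) hier_entry r (squarefree_part u)"
    if r: "linear_order_on (hier_cols (?V - {v}) d) r"
      and u: "nonstandard (hier_rows (link v C) d) (hier_cols (?V - {v}) d) hier_entry r u" for r u
  proof (rule nonstandard_link_squarefree[OF V v C assms(4) dv r _ u])
    fix t assume t: "nonstandard (hier_rows C d) (hier_cols ?V d) hier_entry (level_lex ?V d v r) t"
    \<comment> \<open>Compressedness covers every linear order of the columns, in particular the one
      built from \<open>r\<close> by comparing levels first.\<close>
    have "linear_order_on (hier_cols ?V d) (level_lex ?V d v r)"
      by (rule linear_order_level_lex[OF V v r])
    then show "nonstandard (hier_rows C d) (hier_cols ?V d) hier_entry (level_lex ?V d v r) (squarefree_part t)"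
      using assms(3) t unfolding hier_compressed_def compressed_def squarefree_initial_ideal_iff by blast
  qed
  ultimately show ?thesis
    unfolding hier_compressed_def compressed_def squarefree_initial_ideal_iff
      hier_cols_restrict_levels hier_rows_restrict_levels[OF link]
    by blast
qed

end
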